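(* Let $A$ be a unital $C^*$-algebra and let $\Gamma$ be a discrete subgroup of its unitary group $\mathrm{U}(A)$. Then the subgroup $$\Gamma_{1/2}=\langle g\in\Gamma \mid \|1-g\|<1/2\rangle$$ is abelian and normal in $\Gamma$.
   Context: $\|\cdot\|$ is the $C^*$-norm of $A$; $\mathrm{U}(A)$ carries the norm topology and discreteness of $\Gamma$ refers to it. $\langle S\rangle$ denotes the subgroup generated by $S$. *)

theory Defs
  imports "HOL-Analysis.Analysis" "HOL-Algebra.Generated_Groups"
begin

(* Unital C*-algebras.  The real Banach algebra structure comes from the library
   classes; complex scalars and the involution adj (written x* in the literature)
   are added on top.  The unit comes from monoid_mult rather than from ring_1, so
   that 0 = 1 is allowed and the zero algebra is included; otherwise norm 1 = 1
   is a consequence of the C*-identity. *)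
class unital_cstar_algebra = real_normed_algebra + banach + monoid_mult +
  fixes scaleC :: "complex \<Rightarrow> 'a \<Rightarrow> 'a" (infixr \<open>*\<^sub>C\<close> 75)
    and adj :: "'a \<Rightarrow> 'a"
  assumes scaleC_add_right: "a *\<^sub>C (x + y) = a *\<^sub>C x + a *\<^sub>C y"
    and scaleC_add_left: "(a + b) *\<^sub>C x = a *\<^sub>C x + b *\<^sub>C x"
    and scaleC_scaleC: "a *\<^sub>C (b *\<^sub>C x) = (a * b) *\<^sub>C x"
    and scaleC_of_real: "complex_of_real r *\<^sub>C x = r *\<^sub>R x"
    and norm_scaleC: "norm (a *\<^sub>C x) = cmod a * norm x"
    and mult_scaleC_left: "(a *\<^sub>C x) * y = a *\<^sub>C (x * y)"
    and mult_scaleC_right: "x * (a *\<^sub>C y) = a *\<^sub>C (x * y)"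
    and adj_add: "adj (x + y) = adj x + adj y"
    and adj_scaleC: "adj (a *\<^sub>C x) = cnj a *\<^sub>C adj x"
    and adj_mult: "adj (x * y) = adj y * adj x"
    and adj_adj: "adj (adj x) = x"
    and cstar_identity: "norm (adj x * x) = (norm x)\<^sup>2"

definition unitary_group :: "'a::unital_cstar_algebra monoid" where
  "unitary_group = \<lparr>carrier = {u. adj u * u = 1 \<and> u * adj u = 1}, mult = (*), one = 1\<rparr>"

lemma adj_one: "adj (1::'a::unital_cstar_algebra) = 1"
  by (metis adj_adj adj_mult mult.left_neutral mult.right_neutral)

lemma group_unitary_group: "group (unitary_group :: 'a::unital_cstar_algebra monoid)"
proof (rule groupI)
  fix x y :: 'a
  assume "x \<in> carrier unitary_group" "y \<in> carrier unitary_group"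
  then have x: "adj x * x = 1" "x * adj x = 1" and y: "adj y * y = 1" "y * adj y = 1"
    by (auto simp: unitary_group_def)
  have "adj (x * y) * (x * y) = adj y * ((adj x * x) * y)"
    by (simp only: adj_mult mult.assoc)
  moreover have "(x * y) * adj (x * y) = x * ((y * adj y) * adj x)"
    by (simp only: adj_mult mult.assoc)
  ultimately show "x \<otimes>\<^bsub>unitary_group\<^esub> y \<in> carrier unitary_group"
    by (simp add: unitary_group_def x y)
next
  fix x :: 'a assume "x \<in> carrier unitary_group"
  then show "\<exists>y\<in>carrier unitary_group. y \<otimes>\<^bsub>unitary_group\<^esub> x = \<one>\<^bsub>unitary_group\<^esub>"
    by (intro bexI[of _ "adj x"]) (auto simp: unitary_group_def adj_adj)
qed (auto simp: unitary_group_def adj_one mult.assoc)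

definition gamma_half :: "'a::unital_cstar_algebra set \<Rightarrow> 'a set" where
  "gamma_half \<Gamma> = generate unitary_group {g \<in> \<Gamma>. norm (1 - g) < 1/2}"

end

theory Submission
  imports Defs
begin

text \<open>
  The theorem is a form of the Zassenhaus lemma, and the proof rests on two facts about unitaries
  \<open>g\<close> and \<open>h\<close> with commutator \<open>[g, h] = g h g\<^sup>* h\<^sup>*\<close>.

  Close to \<open>1\<close>, commutators contract: \<open>\<parallel>1 - [g, h]\<parallel> \<le> 2 \<parallel>1 - g\<parallel> \<parallel>1 - h\<parallel>\<close>
  (\<open>norm_one_minus_commutator\<close>). So if \<open>\<parallel>1 - g\<parallel> < 1/2\<close>, the iterated commutators
  \<open>h, [g, h], [g, [g, h]], \<dots>\<close> converge to \<open>1\<close>, and in a discrete group they reach \<open>1\<close> after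
  finitely many steps.

  It remains to climb back from a trivial iterated commutator to \<open>[g, h] = 1\<close>. This is the purpose
  of \<open>commutator_eq_one_if_commutes\<close>: if \<open>g\<close> commutes with \<open>c = [g, h]\<close> and
  \<open>\<parallel>1 - h\<parallel> < 1/2\<close>, then \<open>c = 1\<close>. Indeed \<open>c\<^sup>n h = g\<^sup>n h g\<^sup>-\<^sup>n\<close> is as
  close to \<open>1\<close> as \<open>h\<close>, so all powers of \<open>c\<close> stay within a distance \<open>r < 1\<close> of \<open>1\<close>,
  and only \<open>c = 1\<close> does that (\<open>eq_one_if_powers_near_one\<close>). This replaces the usual argument
  with eigenvalues, or with logarithms, by norm estimates.

  Hence the generators of \<open>\<Gamma>\<^sub>1\<^sub>/\<^sub>2\<close> commute pairwise, which makes the group abelian. It is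
  normal because conjugation by an element of \<open>\<Gamma>\<close> maps \<open>\<Gamma>\<close> to itself and preserves the
  distance to \<open>1\<close> (\<open>norm_one_minus_conjugate\<close>), and so permutes the generators.
\<close>

section \<open>Unitaries act isometrically\<close>

lemma unitaryD:
  assumes "u \<in> carrier unitary_group"
  shows "adj u * u = 1" "u * adj u = 1" "adj u * (u * x) = x" "u * (adj u * x) = x"
  using assms by (simp_all add: unitary_group_def flip: mult.assoc)

lemma adj_unitary: "u \<in> carrier unitary_group \<Longrightarrow> adj u \<in> carrier unitary_group"
  by (simp add: unitary_group_def adj_adj)

lemma inv_unitary:
  assumes "u \<in> carrier unitary_group"
  shows "inv\<^bsub>unitary_group\<^esub> u = adj u"
  using group.inv_equality[OF group_unitary_group _ assms adj_unitary[OF assms]] unitaryD(1)[OF assms]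
  by (simp add: unitary_group_def)

lemma mult_unitary_group: "x \<otimes>\<^bsub>unitary_group\<^esub> y = x * y"
  by (simp add: unitary_group_def)

text \<open>Only an inequality holds here: in the zero algebra the unitary \<open>0 = 1\<close> has norm \<open>0\<close>.\<close>

lemma norm_unitary_le_one:
  fixes u :: "'a::unital_cstar_algebra"
  assumes "u \<in> carrier unitary_group"
  shows "norm u \<le> 1"
proof -
  have "norm (1::'a) = (norm (1::'a))\<^sup>2"
    using cstar_identity[of "1::'a"] by (simp add: adj_one)
  then have "norm (1::'a) \<le> 1"
    unfolding power2_eq_square by (metis mult_cancel_right1 order_refl zero_le_one)
  moreover have "(norm u)\<^sup>2 = norm (1::'a)"
    using cstar_identity[of u] unitaryD(1)[OF assms] by simp
  ultimately show ?thesis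
    by (metis abs_norm_cancel abs_square_le_1)
qed

lemma norm_unitary_mult_left:
  assumes "u \<in> carrier unitary_group"
  shows "norm (u * x) = norm x"
proof (rule antisym)
  have shrink: "norm (v * y) \<le> norm y" if "v \<in> carrier unitary_group" for v y :: 'a
    using norm_mult_ineq[of v y] mult_right_mono[OF norm_unitary_le_one[OF that] norm_ge_zero[of y]]
    by simp
  show "norm (u * x) \<le> norm x"
    by (rule shrink[OF assms])
  show "norm x \<le> norm (u * x)"
    using shrink[OF adj_unitary[OF assms], of "u * x"] by (simp add: unitaryD(3)[OF assms])
qed

lemma norm_unitary_mult_right:
  assumes "u \<in> carrier unitary_group"
  shows "norm (x * u) = norm x"
proof (rule antisym)
  have shrink: "norm (y * v) \<le> norm y" if "v \<in> carrier unitary_group" for v y :: 'a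
    using norm_mult_ineq[of y v] mult_left_mono[OF norm_unitary_le_one[OF that] norm_ge_zero[of y]]
    by simp
  show "norm (x * u) \<le> norm x"
    by (rule shrink[OF assms])
  show "norm x \<le> norm (x * u)"
    using shrink[OF adj_unitary[OF assms], of "x * u"] by (simp add: mult.assoc unitaryD(2)[OF assms])
qed

lemma norm_one_minus_conjugate:
  assumes "u \<in> carrier unitary_group"
  shows "norm (1 - u * x * adj u) = norm (1 - x)"
proof -
  have "1 - u * x * adj u = u * (1 - x) * adj u"
    by (simp add: right_diff_distrib left_diff_distrib unitaryD(2)[OF assms])
  then show ?thesis
    by (simp add: norm_unitary_mult_left norm_unitary_mult_right assms adj_unitary)
qed

section \<open>Powers near the identity\<close>

text \<open>
  Let \<open>s\<close> be the supremum of all \<open>\<parallel>1 - c\<^sup>n\<parallel>\<close>. Squaring nearly doubles the distance to \<open>1\<close>: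
  \<open>2 (1 - x) = (1 - x\<^sup>2) + (1 - x)\<^sup>2\<close> gives \<open>2 s \<le> s + r s\<close>, and so \<open>s = 0\<close>.
\<close>

lemma eq_one_if_powers_near_one:
  fixes c :: "'a::unital_cstar_algebra"
  assumes near: "\<And>n. norm (1 - c ^ n) \<le> r" and "r < 1"
  shows "c = 1"
proof -
  define s where "s = (SUP n. norm (1 - c ^ n))"
  have "bdd_above (range (\<lambda>n. norm (1 - c ^ n)))"
    using near by (auto intro!: bdd_aboveI)
  then have le_s: "norm (1 - c ^ n) \<le> s" for n
    unfolding s_def by (intro cSUP_upper) auto
  then have "0 \<le> s"
    using norm_ge_zero order_trans by blast
  have "norm (1 - c ^ n) \<le> (s + r * s) / 2" for n
  proof -
    let ?x = "c ^ n"
    have "2 *\<^sub>R (1 - ?x) = (1 - c ^ (n + n)) + (1 - ?x) * (1 - ?x)"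
      by (simp add: power_add algebra_simps scaleR_2)
    then have "2 * norm (1 - ?x) = norm ((1 - c ^ (n + n)) + (1 - ?x) * (1 - ?x))"
      by (metis abs_numeral norm_scaleR)
    also have "\<dots> \<le> norm (1 - c ^ (n + n)) + norm (1 - ?x) * norm (1 - ?x)"
      by (meson add_left_mono norm_mult_ineq norm_triangle_ineq order_trans)
    also have "\<dots> \<le> s + r * s"
      using le_s near \<open>0 \<le> s\<close> by (intro add_mono mult_mono') auto
    finally show ?thesis
      by simp
  qed
  then have "s \<le> (s + r * s) / 2"
    unfolding s_def[symmetric] by (subst s_def, intro cSUP_least) auto
  then have "(1 - r) * s \<le> 0"
    by (simp add: algebra_simps)
  then have "s \<le> 0"
    using \<open>r < 1\<close> by (simp add: mult_le_0_iff)
  then have "norm (1 - c ^ 1) \<le> 0"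
    using le_s order_trans by blast
  then show ?thesis
    by simp
qed

section \<open>Commutators near the identity\<close>

definition commutator :: "'a::unital_cstar_algebra \<Rightarrow> 'a \<Rightarrow> 'a" where
  "commutator g h = g * h * adj g * adj h"

lemma commutator_closed:
  assumes "subgroup \<Gamma> unitary_group" "g \<in> \<Gamma>" "h \<in> \<Gamma>"
  shows "commutator g h \<in> \<Gamma>"
proof -
  have "adj x \<in> \<Gamma>" if "x \<in> \<Gamma>" for x
    using subgroup.m_inv_closed[OF assms(1) that]
      inv_unitary[OF subgroup.mem_carrier[OF assms(1) that]] by simp
  then show ?thesis
    using assms subgroup.m_closed[OF assms(1)] by (simp add: commutator_def mult_unitary_group)
qed

lemma commutator_mult:
  assumes "g \<in> carrier unitary_group" "h \<in> carrier unitary_group"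
  shows "commutator g h * h = g * h * adj g"
  by (simp add: commutator_def mult.assoc unitaryD[OF assms(2)])

lemma commutes_if_commutator_eq_one:
  assumes "g \<in> carrier unitary_group" "h \<in> carrier unitary_group" "commutator g h = 1"
  shows "g * h = h * g"
proof -
  have "h * g = g * h * (adj g * g)"
    using commutator_mult[OF assms(1,2)] assms(3) by (simp add: mult.assoc[symmetric])
  then show ?thesis
    by (simp add: unitaryD[OF assms(1)])
qed

text \<open>
  The commutator differs from \<open>1\<close> by a unitary multiple of \<open>h g - g h\<close>, and this additive
  commutator does not change when \<open>g\<close> and \<open>h\<close> are replaced by \<open>1 - g\<close> and \<open>1 - h\<close>.
\<close>

lemma norm_one_minus_commutator:
  assumes g: "g \<in> carrier unitary_group" and h: "h \<in> carrier unitary_group"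
  shows "norm (1 - commutator g h) \<le> 2 * norm (1 - g) * norm (1 - h)"
proof -
  have "1 - commutator g h = (h * g - g * h) * adj g * adj h"
    by (simp add: commutator_def left_diff_distrib mult.assoc unitaryD g h)
  then have "norm (1 - commutator g h) = norm (h * g - g * h)"
    by (simp add: norm_unitary_mult_right adj_unitary g h)
  also have "h * g - g * h = (1 - h) * (1 - g) - (1 - g) * (1 - h)"
    by (simp add: algebra_simps)
  also have "norm \<dots> \<le> norm (1 - h) * norm (1 - g) + norm (1 - g) * norm (1 - h)"
    by (meson add_mono norm_mult_ineq norm_triangle_ineq4 order_trans)
  finally show ?thesis
    by (simp add: mult.commute mult.left_commute)
qed

text \<open>
  The element \<open>h\<close> is conjugated by powers of \<open>g\<close>: since \<open>g h g\<^sup>* = c h\<close> and \<open>g\<close> commutes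
  with \<open>c\<close>, conjugating \<open>n\<close> times gives \<open>c\<^sup>n h\<close>, whose distance to \<open>1\<close> is still
  \<open>\<parallel>1 - h\<parallel>\<close>. The triangle inequality then bounds \<open>\<parallel>1 - c\<^sup>n\<parallel> = \<parallel>h - c\<^sup>n h\<parallel>\<close> by
  \<open>2 \<parallel>1 - h\<parallel> < 1\<close>.
\<close>

lemma commutator_eq_one_if_commutes:
  assumes g: "g \<in> carrier unitary_group" and h: "h \<in> carrier unitary_group"
    and near: "norm (1 - h) < 1/2"
    and comm: "g * commutator g h = commutator g h * g"
  shows "commutator g h = 1"
proof (rule eq_one_if_powers_near_one)
  let ?c = "commutator g h"
  have conj: "norm (1 - ?c ^ n * h) = norm (1 - h)" for n
  proof (induction n)
    case (Suc n)
    have "?c ^ Suc n * h = ?c ^ n * (?c * h)"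
      by (simp only: power_Suc2 mult.assoc)
    also have "\<dots> = ?c ^ n * g * h * adj g"
      by (simp add: commutator_mult g h mult.assoc)
    also have "?c ^ n * g = g * ?c ^ n"
      using power_commuting_commutes[of ?c g] comm by metis
    finally have "?c ^ Suc n * h = g * (?c ^ n * h) * adj g"
      by (simp add: mult.assoc)
    then show ?case
      using norm_one_minus_conjugate[OF g] Suc by metis
  qed simp
  show "norm (1 - ?c ^ n) \<le> 2 * norm (1 - h)" for n
  proof -
    have "norm (1 - ?c ^ n) = norm ((1 - ?c ^ n) * h)"
      by (simp add: norm_unitary_mult_right h)
    also have "(1 - ?c ^ n) * h = (1 - ?c ^ n * h) - (1 - h)"
      by (simp add: algebra_simps)
    also have "norm \<dots> \<le> 2 * norm (1 - h)"
      using norm_triangle_ineq4[of "1 - ?c ^ n * h" "1 - h"] conj[of n] by simp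
    finally show ?thesis .
  qed
  show "2 * norm (1 - h) < 1"
    using near by simp
qed

text \<open>
  This is where discreteness enters. The iterated commutators \<open>a n\<close> lie in \<open>\<Gamma>\<close>, decay
  geometrically towards \<open>1\<close>, and hence one of them equals \<open>1\<close>. The previous lemma, applied to
  \<open>g\<close> and \<open>a n\<close>, turns \<open>a (n + 2) = 1\<close> into \<open>a (n + 1) = 1\<close>, down to \<open>[g, h] = 1\<close>.
\<close>

lemma discrete_near_one_commute:
  assumes sub: "subgroup \<Gamma> unitary_group" and disc: "discrete \<Gamma>"
    and g: "g \<in> \<Gamma>" "norm (1 - g) < 1/2" and h: "h \<in> \<Gamma>" "norm (1 - h) < 1/2"
  shows "g * h = h * g"
proof -
  define a where "a n = (commutator g ^^ n) h" for n
  have a_0: "a 0 = h" and a_Suc: "a (Suc n) = commutator g (a n)" for n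
    by (simp_all add: a_def)
  have a_in: "a n \<in> \<Gamma>" for n
    by (induction n) (simp_all add: a_0 a_Suc h g commutator_closed[OF sub])
  have unitary: "x \<in> carrier unitary_group" if "x \<in> \<Gamma>" for x
    using subgroup.mem_carrier[OF sub that] .
  define q where "q = 2 * norm (1 - g)"
  have q: "0 \<le> q" "q < 1"
    using g(2) by (simp_all add: q_def)
  have decay: "norm (1 - a n) \<le> q ^ n * norm (1 - h)" for n
  proof (induction n)
    case (Suc n)
    have "norm (1 - a (Suc n)) \<le> q * norm (1 - a n)"
      unfolding a_Suc q_def by (rule norm_one_minus_commutator[OF unitary unitary]) (fact g(1) a_in)+
    also have "\<dots> \<le> q * (q ^ n * norm (1 - h))"
      by (rule mult_left_mono[OF Suc q(1)])
    finally show ?case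
      by (simp add: mult.assoc)
  qed (simp add: a_0)
  have a_near: "norm (1 - a n) < 1/2" for n
  proof -
    have "q ^ n * norm (1 - h) \<le> 1 * norm (1 - h)"
      using q by (intro mult_right_mono power_le_one) auto
    then show ?thesis
      using decay[of n] h(2) by linarith
  qed
  have "1 \<in> \<Gamma>"
    using subgroup.one_closed[OF sub] by (simp add: unitary_group_def)
  then have "1 isolated_in \<Gamma>"
    using disc discreteD by blast
  then obtain e where e: "e > 0" "\<And>y. y \<in> \<Gamma> \<Longrightarrow> dist 1 y < e \<Longrightarrow> y = 1"
    unfolding isolated_in_dist_Ex_iff by blast
  obtain N where N: "q ^ N < e"
    using real_arch_pow_inv[OF e(1) q(2)] by blast
  have "q ^ N * norm (1 - h) \<le> q ^ N * 1"
    using h(2) q(1) by (intro mult_left_mono) auto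
  then have "dist 1 (a N) < e"
    using decay[of N] N by (simp add: dist_norm)
  then have "a N = 1"
    using e(2) a_in by blast
  then have "a (Suc N) = 1"
    by (simp add: a_Suc commutator_def adj_one unitaryD(2)[OF unitary[OF g(1)]])
  then have "a (Suc 0) = 1"
  proof (induction N)
    case (Suc n)
    have "g * a (Suc n) = a (Suc n) * g"
      using Suc.prems
      by (intro commutes_if_commutator_eq_one unitary g(1) a_in) (simp add: a_Suc)
    then have "a (Suc n) = 1"
      unfolding a_Suc
      by (intro commutator_eq_one_if_commutes unitary g(1) a_in a_near)
    then show ?case
      by (rule Suc.IH)
  qed
  then show ?thesis
    by (intro commutes_if_commutator_eq_one unitary g(1) h(1)) (simp add: a_Suc a_0)
qed

section \<open>The subgroup generated by the elements near the identity\<close>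

text \<open>
  Centralizers are subgroups. So the centralizer of \<open>S\<close>, which contains \<open>S\<close>, contains
  \<open>\<langle>S\<rangle>\<close>; then the centralizer of \<open>\<langle>S\<rangle>\<close> contains \<open>S\<close>, and therefore \<open>\<langle>S\<rangle>\<close> too.
\<close>

lemma (in group) comm_group_generate:
  assumes S: "S \<subseteq> carrier G" and comm: "\<And>x y. x \<in> S \<Longrightarrow> y \<in> S \<Longrightarrow> x \<otimes> y = y \<otimes> x"
  shows "comm_group (G\<lparr>carrier := generate G S\<rparr>)"
proof -
  define Z where "Z T = {x \<in> carrier G. \<forall>t\<in>T. x \<otimes> t = t \<otimes> x}" for T
  have Z: "subgroup (Z T) G" if T: "T \<subseteq> carrier G" for T
  proof (rule subgroupI)
    show "Z T \<noteq> {}"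
      using T by (auto simp: Z_def intro!: exI[of _ \<one>])
    fix x assume x: "x \<in> Z T"
    show "inv x \<in> Z T"
    proof -
      have "inv x \<otimes> t = t \<otimes> inv x" if t: "t \<in> T" for t
      proof -
        have c: "x \<in> carrier G" "t \<in> carrier G" and xt: "x \<otimes> t = t \<otimes> x"
          using x t T by (auto simp: Z_def)
        have "inv x \<otimes> t = inv x \<otimes> (t \<otimes> x) \<otimes> inv x"
          using c by (simp add: m_assoc)
        also have "\<dots> = t \<otimes> inv x"
          using c by (simp add: flip: xt) (simp add: flip: m_assoc)
        finally show ?thesis .
      qed
      then show ?thesis
        using x by (simp add: Z_def)
    qed
    fix y assume y: "y \<in> Z T"
    show "x \<otimes> y \<in> Z T"
    proof -
      have "x \<otimes> y \<otimes> t = t \<otimes> (x \<otimes> y)" if t: "t \<in> T" for t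
      proof -
        have c: "x \<in> carrier G" "y \<in> carrier G" "t \<in> carrier G"
          and xy: "x \<otimes> t = t \<otimes> x" "y \<otimes> t = t \<otimes> y"
          using x y t T by (auto simp: Z_def)
        have "x \<otimes> y \<otimes> t = x \<otimes> t \<otimes> y"
          using c by (simp add: m_assoc xy(2))
        then show ?thesis
          using c by (simp add: xy(1) m_assoc)
      qed
      then show ?thesis
        using x y by (simp add: Z_def)
    qed
  qed (auto simp: Z_def)
  have gen: "generate G S \<subseteq> carrier G"
    by (rule generate_incl[OF S])
  have "generate G S \<subseteq> Z S"
    by (rule generate_subgroup_incl[OF _ Z[OF S]]) (use S comm in \<open>auto simp: Z_def\<close>)
  then have "S \<subseteq> Z (generate G S)"
    using S by (fastforce simp: Z_def)
  then have "generate G S \<subseteq> Z (generate G S)"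
    by (rule generate_subgroup_incl[OF _ Z[OF gen]])
  then show ?thesis
    by (intro group.group_comm_groupI subgroup_imp_group generate_is_subgroup[OF S])
      (auto simp: Z_def)
qed

theorem theorem4p1:
  fixes \<Gamma> :: "'a::unital_cstar_algebra set"
  assumes "subgroup \<Gamma> unitary_group"
    and "discrete \<Gamma>"
  shows "comm_group (unitary_group\<lparr>carrier := gamma_half \<Gamma>\<rparr>)
       \<and> gamma_half \<Gamma> \<lhd> unitary_group\<lparr>carrier := \<Gamma>\<rparr>"
proof
  interpret U: group "unitary_group :: 'a monoid"
    by (rule group_unitary_group)
  interpret G: group "unitary_group\<lparr>carrier := \<Gamma>\<rparr>"
    by (rule U.subgroup_imp_group[OF assms(1)])
  let ?S = "{g \<in> \<Gamma>. norm (1 - g) < 1/2}"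
  have carr: "x \<in> carrier unitary_group" if "x \<in> \<Gamma>" for x
    using subgroup.mem_carrier[OF assms(1) that] .
  show "comm_group (unitary_group\<lparr>carrier := gamma_half \<Gamma>\<rparr>)"
    unfolding gamma_half_def
    by (rule U.comm_group_generate)
      (auto simp: mult_unitary_group carr intro: discrete_near_one_commute[OF assms])
  have "generate (unitary_group\<lparr>carrier := \<Gamma>\<rparr>) ?S \<lhd> unitary_group\<lparr>carrier := \<Gamma>\<rparr>"
  proof (rule G.normal_generateI)
    fix h g assume h: "h \<in> ?S" and "g \<in> carrier (unitary_group\<lparr>carrier := \<Gamma>\<rparr>)"
    then have g: "g \<in> \<Gamma>"
      by simp
    have "g \<otimes>\<^bsub>unitary_group\<^esub> h \<otimes>\<^bsub>unitary_group\<^esub> inv\<^bsub>unitary_group\<^esub> g \<in> \<Gamma>"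
      using g h subgroup.m_closed[OF assms(1)] subgroup.m_inv_closed[OF assms(1)] by simp
    then show "g \<otimes>\<^bsub>unitary_group\<lparr>carrier := \<Gamma>\<rparr>\<^esub> h \<otimes>\<^bsub>unitary_group\<lparr>carrier := \<Gamma>\<rparr>\<^esub>
        inv\<^bsub>unitary_group\<lparr>carrier := \<Gamma>\<rparr>\<^esub> g \<in> ?S"
      using h
      by (simp add: U.m_inv_consistent[OF assms(1) g] inv_unitary[OF carr[OF g]] mult_unitary_group
          norm_one_minus_conjugate[OF carr[OF g]])
  qed auto
  then show "gamma_half \<Gamma> \<lhd> unitary_group\<lparr>carrier := \<Gamma>\<rparr>"
    unfolding gamma_half_def by (subst (asm) U.generate_consistent[OF _ assms(1)]) auto
qed

end
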